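(* Let $X$ be a nonempty completely metrizable space with no isolated points. Then $$\mathrm{add}(\mathcal M_X) = \begin{cases} \mathrm{add}(\mathcal M) & \text{if } X \text{ has a } \pi\text{-base consisting of Polish spaces},\\ \aleph_1 & \text{otherwise}.\end{cases}$$
   Context: For a topological space $X$, $\mathcal M_X$ is the collection of all meager subsets of $X$ (countable unions of nowhere dense sets), and $\mathcal M = \mathcal M_{\mathbb R}$. For an ideal $\mathcal I$ of subsets of a set $X$, $\mathrm{add}(\mathcal I) = \min\{|\mathcal J| : \mathcal J \subseteq \mathcal I \text{ and } \bigcup \mathcal J \notin \mathcal I\}$. A $\pi$-base for $X$ is a collection $\mathcal B$ of nonempty open subsets of $X$ such that every nonempty open subset of $X$ contains a member of $\mathcal B$. A $\pi$-base consists of Polish spaces if each of its members, with the subspace topology, is a Polish space (separable and completely metrizable). *)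

theory Defs
  imports "HOL-Analysis.Analysis"
begin

unbundle cardinal_syntax

definition nowhere_dense_in :: "'a topology \<Rightarrow> 'a set \<Rightarrow> bool" where
  "nowhere_dense_in X N \<longleftrightarrow> N \<subseteq> topspace X \<and> X interior_of (X closure_of N) = {}"

definition meager_sets :: "'a topology \<Rightarrow> 'a set set" where
  "meager_sets X = {A. \<exists>\<N>. countable \<N> \<and> (\<forall>N\<in>\<N>. nowhere_dense_in X N) \<and> A = \<Union>\<N>}"

text \<open>The minimum is the cardinality of a subfamily that attains it; the choice of this subfamily
  matters only up to equality of cardinals, that is, up to \<open>=o\<close>. If no subfamily of the ideal has
  its union outside the ideal, the minimum does not exist and the value is unspecified.\<close>

definition additivity :: "'a set set \<Rightarrow> 'a set rel" where
  "additivity \<I> =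
     card_of (SOME \<J>. \<J> \<subseteq> \<I> \<and> \<Union>\<J> \<notin> \<I> \<and> (\<forall>\<K>. \<K> \<subseteq> \<I> \<and> \<Union>\<K> \<notin> \<I> \<longrightarrow> |\<J>| \<le>o |\<K>| ))"

lemma additivity_is_minimum:
  assumes "\<K>\<^sub>0 \<subseteq> \<I>" "\<Union>\<K>\<^sub>0 \<notin> \<I>"
  shows "\<exists>\<J>. \<J> \<subseteq> \<I> \<and> \<Union>\<J> \<notin> \<I> \<and> additivity \<I> = |\<J>|"
    and "\<forall>\<K>. \<K> \<subseteq> \<I> \<and> \<Union>\<K> \<notin> \<I> \<longrightarrow> additivity \<I> \<le>o |\<K>|"
proof -
  let ?P = "\<lambda>\<J>. \<J> \<subseteq> \<I> \<and> \<Union>\<J> \<notin> \<I> \<and> (\<forall>\<K>. \<K> \<subseteq> \<I> \<and> \<Union>\<K> \<notin> \<I> \<longrightarrow> |\<J>| \<le>o |\<K>| )"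
  let ?R = "card_of ` {\<K>. \<K> \<subseteq> \<I> \<and> \<Union>\<K> \<notin> \<I>}"
  have "?R \<noteq> {}" "\<forall>r\<in>?R. Well_order r"
    using assms by (auto simp: card_of_Well_order)
  from exists_minim_Well_order[OF this] have "\<exists>\<J>. ?P \<J>"
    by auto
  then have "?P (SOME \<J>. ?P \<J>)"
    by (rule someI_ex)
  then show "\<exists>\<J>. \<J> \<subseteq> \<I> \<and> \<Union>\<J> \<notin> \<I> \<and> additivity \<I> = |\<J>|"
    and "\<forall>\<K>. \<K> \<subseteq> \<I> \<and> \<Union>\<K> \<notin> \<I> \<longrightarrow> additivity \<I> \<le>o |\<K>|"
    unfolding additivity_def by blast+
qed

definition pi_base :: "'a topology \<Rightarrow> 'a set set \<Rightarrow> bool" where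
  "pi_base X \<B> \<longleftrightarrow>
     (\<forall>B\<in>\<B>. openin X B \<and> B \<noteq> {}) \<and>
     (\<forall>U. openin X U \<and> U \<noteq> {} \<longrightarrow> (\<exists>B\<in>\<B>. B \<subseteq> U))"

definition Polish_topology :: "'a topology \<Rightarrow> bool" where
  "Polish_topology X \<longleftrightarrow> separable_space X \<and> completely_metrizable_space X"

definition has_Polish_pi_base :: "'a topology \<Rightarrow> bool" where
  "has_Polish_pi_base X \<longleftrightarrow>
     (\<exists>\<B>. pi_base X \<B> \<and> (\<forall>B\<in>\<B>. Polish_topology (subtopology X B)))"

end

theory Submission
  imports Defs "HOL-Library.Countable_Set_Type"
begin

text \<open>If \<open>X\<close> has a Polish \<open>\<pi>\<close>-base, a maximal disjoint subfamily of it has dense union, and a set is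
  meager iff its trace on each member is. Each member carries a tree of open sets, splitting
  countably at every node into sets of vanishing diameter with dense union; the branches identify
  it, modulo a meager set, with \<open>\<omega>\<^sup>\<omega>\<close>, nowhere density being read off the tree. The same applies
  to \<open>\<real>\<close>, so both additivities equal that of the meager ideal of \<open>\<omega>\<^sup>\<omega>\<close>.

  Otherwise some nonempty open \<open>U\<close> is nowhere separable, so each of its nonempty open subsets
  contains uncountably many disjoint open sets. Labelling these by countable ordinals at every
  scale \<open>1/n\<close> gives functions \<open>c\<^sub>n : U \<rightarrow> \<omega>\<^sub>1\<close> such that every ball of
  radius \<open>1/n\<close> inside \<open>U\<close> contains, for each countable ordinal, a nonempty open set on which \<open>c\<^sub>n\<close> takes that value. Then \<open>{x. \<forall>n. c\<^sub>n x \<le> \<alpha>}\<close> is nowhere dense for every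
  \<open>\<alpha> < \<omega>\<^sub>1\<close>, and these sets cover \<open>U\<close> by regularity of \<open>\<omega>\<^sub>1\<close>.\<close>

section \<open>Meager sets\<close>

lemma openin_subset_closure_of: "openin X U \<Longrightarrow> U \<subseteq> X closure_of U"
  by (simp add: closure_of_subset openin_subset)

text \<open>Meager sets of a space and \<open>meager_seqs\<close> both arise this way, from two
  notions of nowhere density; their common closure properties are proved at this level.\<close>

definition countable_unions :: "'a set set \<Rightarrow> 'a set set" where
  "countable_unions \<N> = {\<Union>\<C> |\<C>. countable \<C> \<and> \<C> \<subseteq> \<N>}"

lemma in_countable_unions_iff:
  "A \<in> countable_unions \<N> \<longleftrightarrow> (\<exists>\<C>. countable \<C> \<and> \<C> \<subseteq> \<N> \<and> A = \<Union>\<C>)"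
  by (auto simp: countable_unions_def)

lemma countable_unions_base: "N \<in> \<N> \<Longrightarrow> N \<in> countable_unions \<N>"
  unfolding countable_unions_def by (auto intro!: exI[of _ "{N}"])

lemma countable_unions_subset:
  assumes "\<And>M N. N \<in> \<N> \<Longrightarrow> M \<subseteq> N \<Longrightarrow> M \<in> \<N>" "A \<in> countable_unions \<N>" "B \<subseteq> A"
  shows "B \<in> countable_unions \<N>"
proof -
  obtain \<C> where \<C>: "countable \<C>" "\<C> \<subseteq> \<N>" "A = \<Union>\<C>"
    using assms(2) by (auto simp: countable_unions_def)
  have "countable ((\<lambda>N. N \<inter> B) ` \<C>)" "(\<lambda>N. N \<inter> B) ` \<C> \<subseteq> \<N>" "B = \<Union>((\<lambda>N. N \<inter> B) ` \<C>)"
    using \<C> assms(1,3) by auto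
  then show ?thesis
    unfolding countable_unions_def by blast
qed

lemma countable_unions_UN:
  assumes "countable I" "\<And>i. i \<in> I \<Longrightarrow> A i \<in> countable_unions \<N>"
  shows "(\<Union>i\<in>I. A i) \<in> countable_unions \<N>"
proof -
  obtain \<C> where \<C>: "\<And>i. i \<in> I \<Longrightarrow> countable (\<C> i) \<and> \<C> i \<subseteq> \<N> \<and> A i = \<Union>(\<C> i)"
    using assms(2) unfolding countable_unions_def mem_Collect_eq by metis
  have "countable (\<Union>i\<in>I. \<C> i)" "(\<Union>i\<in>I. \<C> i) \<subseteq> \<N>" "(\<Union>i\<in>I. A i) = \<Union>(\<Union>i\<in>I. \<C> i)"
    using \<C> assms(1) by auto
  then show ?thesis
    unfolding countable_unions_def by blast
qed

lemma countable_unions_Un: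
  assumes "A \<in> countable_unions \<N>" "B \<in> countable_unions \<N>"
  shows "A \<union> B \<in> countable_unions \<N>"
  using countable_unions_UN[of "{A, B}" id] assms by auto

text \<open>The empty set pads a finite or empty family to a full sequence. Indexing by all of
  \<open>nat\<close> lets decompositions of many sets be combined term by term in
  \<open>meager_sets_glue\<close>.\<close>

lemma countable_unions_sequence:
  assumes "{} \<in> \<N>" "A \<in> countable_unions \<N>"
  shows "\<exists>N :: nat \<Rightarrow> 'a set. (\<forall>n. N n \<in> \<N>) \<and> A = (\<Union>n. N n)"
proof -
  obtain \<C> where \<C>: "countable \<C>" "\<C> \<subseteq> \<N>" "A = \<Union>\<C>"
    using assms(2) by (auto simp: countable_unions_def)
  then have r: "range (from_nat_into (insert {} \<C>)) = insert {} \<C>"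
    by (intro range_from_nat_into) auto
  then have "\<forall>n. from_nat_into (insert {} \<C>) n \<in> \<N>"
    using \<C>(2) assms(1) by (metis insertE rangeI subsetD)
  moreover have "A = (\<Union>n. from_nat_into (insert {} \<C>) n)"
    using r \<C>(3) by auto
  ultimately show ?thesis by blast
qed

section \<open>Nowhere dense sets, meager sets and Baire category\<close>

lemma meager_sets_eq: "meager_sets X = countable_unions {N. nowhere_dense_in X N}"
  unfolding meager_sets_def countable_unions_def by (auto simp: subset_iff)

text \<open>Removing the closure of \<open>N\<close> from \<open>W\<close> gives \<open>V\<close>;
  conversely, an open set disjoint from \<open>N\<close> is disjoint from its closure. This
  refinement form is the one that can be checked on a tree of open sets or on a dense disjoint
  family.\<close>

lemma nowhere_dense_in_iff:
  "nowhere_dense_in X N \<longleftrightarrow> N \<subseteq> topspace X \<and>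
    (\<forall>W. openin X W \<and> W \<noteq> {} \<longrightarrow> (\<exists>V. openin X V \<and> V \<noteq> {} \<and> V \<subseteq> W \<and> V \<inter> N = {}))"
proof (cases "N \<subseteq> topspace X")
  case True
  show ?thesis
  proof
    assume L: "nowhere_dense_in X N"
    have "\<exists>V. openin X V \<and> V \<noteq> {} \<and> V \<subseteq> W \<and> V \<inter> N = {}" if W: "openin X W" "W \<noteq> {}" for W
    proof (intro exI conjI)
      show "openin X (W - X closure_of N)"
        using W by (simp add: openin_diff)
      show "W - X closure_of N \<noteq> {}"
        using L W interior_of_maximal[of W "X closure_of N" X] unfolding nowhere_dense_in_def by blast
      show "(W - X closure_of N) \<inter> N = {}"
        using closure_of_subset[OF True] by blast
    qed blast
    with True show "N \<subseteq> topspace X \<and>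
      (\<forall>W. openin X W \<and> W \<noteq> {} \<longrightarrow> (\<exists>V. openin X V \<and> V \<noteq> {} \<and> V \<subseteq> W \<and> V \<inter> N = {}))"
      by blast
  next
    assume R: "N \<subseteq> topspace X \<and>
      (\<forall>W. openin X W \<and> W \<noteq> {} \<longrightarrow> (\<exists>V. openin X V \<and> V \<noteq> {} \<and> V \<subseteq> W \<and> V \<inter> N = {}))"
    have "X interior_of (X closure_of N) = {}"
    proof (rule ccontr)
      assume "X interior_of (X closure_of N) \<noteq> {}"
      then obtain V where V: "openin X V" "V \<noteq> {}" "V \<subseteq> X interior_of (X closure_of N)" "V \<inter> N = {}"
        using R by (meson openin_interior_of)
      then have "V \<inter> X closure_of N = {}"
        by (simp add: openin_Int_closure_of_eq_empty)
      with V show False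
        using interior_of_subset[of X "X closure_of N"] by blast
    qed
    with True show "nowhere_dense_in X N"
      by (simp add: nowhere_dense_in_def)
  qed
next
  case False
  then show ?thesis by (simp add: nowhere_dense_in_def)
qed

lemma nowhere_dense_in_subset: "nowhere_dense_in X N \<Longrightarrow> M \<subseteq> N \<Longrightarrow> nowhere_dense_in X M"
  unfolding nowhere_dense_in_def
  by (metis closure_of_mono interior_of_mono order_trans subset_empty)

lemma meager_sets_subset: "A \<in> meager_sets X \<Longrightarrow> B \<subseteq> A \<Longrightarrow> B \<in> meager_sets X"
  unfolding meager_sets_eq by (erule countable_unions_subset[rotated]) (auto intro: nowhere_dense_in_subset)

lemma meager_sets_UN:
  "countable I \<Longrightarrow> (\<And>i. i \<in> I \<Longrightarrow> A i \<in> meager_sets X) \<Longrightarrow> (\<Union>i\<in>I. A i) \<in> meager_sets X"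
  unfolding meager_sets_eq by (rule countable_unions_UN)

lemma nowhere_dense_imp_meager: "nowhere_dense_in X N \<Longrightarrow> N \<in> meager_sets X"
  unfolding meager_sets_eq by (auto intro: countable_unions_base)

lemma meager_sets_subset_topspace: "A \<in> meager_sets X \<Longrightarrow> A \<subseteq> topspace X"
  unfolding meager_sets_def nowhere_dense_in_def by auto

text \<open>The Baire category theorem, applied to the closures of the nowhere dense pieces.\<close>

lemma open_not_meager:
  assumes "completely_metrizable_space X" "openin X U" "U \<noteq> {}"
  shows "U \<notin> meager_sets X"
proof
  assume "U \<in> meager_sets X"
  then obtain \<N> where \<N>: "countable \<N>" "\<forall>N\<in>\<N>. nowhere_dense_in X N" "U = \<Union>\<N>"
    by (auto simp: meager_sets_def)
  have "X interior_of \<Union>((closure_of) X ` \<N>) = {}"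
    using \<N> assms(1) by (intro Baire_category_alt) (auto simp: nowhere_dense_in_def)
  moreover have "U \<subseteq> \<Union>((closure_of) X ` \<N>)"
    using \<N> closure_of_subset unfolding nowhere_dense_in_def by fastforce
  ultimately show False
    using assms interior_of_maximal by blast
qed

text \<open>A singleton is closed, so the interior in question is empty or \<open>{x}\<close>, and
  the latter would isolate \<open>x\<close>.\<close>

lemma nowhere_dense_singleton:
  assumes "t1_space X" "x \<in> topspace X" "\<not> openin X {x}"
  shows "nowhere_dense_in X {x}"
  unfolding nowhere_dense_in_def
proof
  have "closedin X {x}"
    using assms by (simp add: t1_space_closedin_singleton)
  then have "X interior_of (X closure_of {x}) \<subseteq> {x}"
    using interior_of_subset[of X "{x}"] by (simp add: closure_of_closedin)
  then show "X interior_of (X closure_of {x}) = {}"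
    using assms(3) openin_interior_of by (metis subset_singletonD)
qed (use assms in auto)

text \<open>The family of all singletons serves. Such a witness guarantees that the minimum defining
  \<open>additivity\<close> exists.\<close>

lemma exists_family_with_nonmeager_Union:
  assumes "topspace X \<noteq> {}" "completely_metrizable_space X" "\<forall>x\<in>topspace X. \<not> openin X {x}"
  obtains \<K> where "\<K> \<subseteq> meager_sets X" "\<Union>\<K> \<notin> meager_sets X"
proof
  have "t1_space X"
    using assms(2) completely_metrizable_imp_metrizable_space metrizable_imp_t1_space by blast
  then show "(\<lambda>x. {x}) ` topspace X \<subseteq> meager_sets X"
    using assms(3) by (auto intro!: nowhere_dense_imp_meager nowhere_dense_singleton)
  show "\<Union>((\<lambda>x. {x}) ` topspace X) \<notin> meager_sets X"
    using open_not_meager[OF assms(2), of "topspace X"] assms(1) by simp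
qed

section \<open>Maximal disjoint families\<close>

text \<open>Zorn's lemma: disjointness survives unions of chains, and a member of
  \<open>\<C>\<close> meeting nothing in a maximal family could be added to it.\<close>

lemma exists_maximal_disjoint_subfamily:
  assumes "{} \<notin> \<C>"
  obtains \<D> where "\<D> \<subseteq> \<C>" "disjoint \<D>" "\<And>C. C \<in> \<C> \<Longrightarrow> \<exists>D\<in>\<D>. C \<inter> D \<noteq> {}"
proof -
  have "\<exists>\<D>\<in>{\<D>. \<D> \<subseteq> \<C> \<and> disjoint \<D>}. \<forall>\<E>\<in>{\<D>. \<D> \<subseteq> \<C> \<and> disjoint \<D>}. \<D> \<subseteq> \<E> \<longrightarrow> \<E> = \<D>"
  proof (rule subset_Zorn', safe)
    fix \<T> x assume "subset.chain {\<D>. \<D> \<subseteq> \<C> \<and> disjoint \<D>} \<T>"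
    then show "disjoint (\<Union>\<T>)"
      unfolding subset_chain_def by (intro pairwise_chain_Union) (auto simp: chain_subset_def)
  qed (auto simp: subset_chain_def)
  then obtain \<D> where \<D>: "\<D> \<subseteq> \<C>" "disjoint \<D>"
    and max: "\<And>\<E>. \<E> \<subseteq> \<C> \<Longrightarrow> disjoint \<E> \<Longrightarrow> \<D> \<subseteq> \<E> \<Longrightarrow> \<E> = \<D>"
    by auto
  have "\<exists>D\<in>\<D>. C \<inter> D \<noteq> {}" if "C \<in> \<C>" for C
  proof (rule ccontr)
    assume no: "\<not> (\<exists>D\<in>\<D>. C \<inter> D \<noteq> {})"
    then have "disjoint (insert C \<D>)"
      using \<D> by (auto simp: pairwise_insert disjnt_def)
    then have "insert C \<D> = \<D>"
      using that \<D> by (intro max) auto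
    \<comment> \<open>By maximality \<open>C\<close> already lies in \<open>\<D>\<close>, so it is
      among the sets it does not meet.\<close>
    then have "C \<inter> C = {}"
      using no by auto
    with assms that show False by simp
  qed
  with \<D> show thesis by (rule that)
qed

section \<open>Countable chain condition and splitting\<close>

text \<open>Formulated with open sets of \<open>X\<close> so that it passes to smaller sets without
  subspace topologies; for open \<open>B\<close> it is the chain condition of the subspace.\<close>

definition countable_chain_condition :: "'a topology \<Rightarrow> 'a set \<Rightarrow> bool" where
  "countable_chain_condition X B \<longleftrightarrow>
     (\<forall>\<D>. disjoint \<D> \<and> (\<forall>D\<in>\<D>. openin X D \<and> D \<noteq> {} \<and> D \<subseteq> B) \<longrightarrow> countable \<D>)"

lemma countable_chain_condition_subset:
  "countable_chain_condition X B \<Longrightarrow> A \<subseteq> B \<Longrightarrow> countable_chain_condition X A"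
  unfolding countable_chain_condition_def by (meson order_trans)

text \<open>Each member contains a point of a countable dense set, and by disjointness the choice of
  such points is injective.\<close>

lemma separable_imp_countable_chain_condition:
  assumes "openin X B" "separable_space (subtopology X B)"
  shows "countable_chain_condition X B"
  unfolding countable_chain_condition_def
proof clarify
  fix \<D> assume disj: "disjoint \<D>" and \<D>: "\<forall>D\<in>\<D>. openin X D \<and> D \<noteq> {} \<and> D \<subseteq> B"
  obtain C where C: "countable C" "subtopology X B closure_of C = topspace (subtopology X B)"
    using assms(2) by (auto simp: separable_space_def)
  have "D \<inter> C \<noteq> {}" if "D \<in> \<D>" for D
  proof -
    have "openin (subtopology X B) D"
      using \<D> assms(1) that by (simp add: openin_open_subtopology)
    then have "D \<inter> C = {} \<longleftrightarrow> D \<inter> topspace (subtopology X B) = {}"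
      by (metis C(2) openin_Int_closure_of_eq_empty)
    moreover have "D \<subseteq> topspace (subtopology X B)"
      using \<open>openin (subtopology X B) D\<close> openin_subset by blast
    moreover have "D \<noteq> {}"
      using \<D> that by auto
    ultimately show ?thesis
      by (simp add: inf.absorb1)
  qed
  then have "\<forall>D\<in>\<D>. \<exists>x. x \<in> D \<inter> C"
    by auto
  then obtain p where p: "\<And>D. D \<in> \<D> \<Longrightarrow> p D \<in> D \<inter> C"
    by metis
  have "inj_on p \<D>"
  proof (intro inj_onI ccontr[of "_ = _"])
    fix D E assume "D \<in> \<D>" "E \<in> \<D>" "p D = p E" "D \<noteq> E"
    then show False
      using p[of D] p[of E] disjointD[OF disj] by auto
  qed
  moreover have "countable (p ` \<D>)"
    using p by (intro countable_subset[OF _ C(1)]) auto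
  ultimately show "countable \<D>"
    using countable_image_inj_on by blast
qed

text \<open>Without isolated points \<open>W\<close> contains some \<open>q\<close> other than
  \<open>p\<close>; a small enough ball about \<open>q\<close> has all the properties.\<close>

lemma (in Metric_space) exists_small_open:
  assumes "\<forall>x\<in>M. \<not> openin mtopology {x}" "openin mtopology W" "W \<noteq> {}" "\<epsilon> > 0"
  obtains E where "openin mtopology E" "E \<noteq> {}" "mtopology closure_of E \<subseteq> W"
    "p \<notin> mtopology closure_of E" "\<And>x y. x \<in> E \<Longrightarrow> y \<in> E \<Longrightarrow> d x y < \<epsilon>"
proof -
  have "W \<subseteq> M"
    using assms(2) openin_mtopology by blast
  have "W \<noteq> {p}"
    using assms(1,2) \<open>W \<subseteq> M\<close> by blast
  then obtain q where q: "q \<in> W" "q \<noteq> p"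
    using assms(3) by blast
  then have "q \<in> M"
    using \<open>W \<subseteq> M\<close> by blast
  obtain r where r: "r > 0" "mball q r \<subseteq> W"
    using assms(2) q openin_mtopology by blast
  \<comment> \<open>Distance within which the ball must stay to avoid \<open>p\<close>. A point
    outside \<open>M\<close> lies in no closed ball, so the default \<open>1\<close> only has to be
    positive.\<close>
  define \<delta> where "\<delta> = (if p \<in> M then d q p else 1)"
  have "\<delta> > 0"
    using q \<open>q \<in> M\<close> by (simp add: \<delta>_def mdist_pos_less)
  define s where "s = min (r/2) (min (\<epsilon>/2) (\<delta>/2))"
  have s: "s > 0" "s < r" "s \<le> \<epsilon>/2" "s < \<delta>"
    using r assms(4) \<open>\<delta> > 0\<close> by (auto simp: s_def)
  have cl: "mtopology closure_of (mball q s) \<subseteq> mcball q s"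
    by (intro closure_of_minimal) auto
  show thesis
  proof
    show "openin mtopology (mball q s)" by simp
    show "mball q s \<noteq> {}"
      using s \<open>q \<in> M\<close> centre_in_mball_iff by blast
    have "mcball q s \<subseteq> mball q r"
      using s by auto
    then show "mtopology closure_of (mball q s) \<subseteq> W"
      using cl r by blast
    have "p \<notin> mcball q s"
      using s by (auto simp: \<delta>_def)
    then show "p \<notin> mtopology closure_of (mball q s)"
      using cl by blast
    show "d x y < \<epsilon>" if "x \<in> mball q s" "y \<in> mball q s" for x y
      using that s triangle[of x q y] commute[of x q] by auto
  qed
qed

text \<open>A maximal disjoint family of small open sets is dense in \<open>V\<close> by maximality
  and countable by the chain condition. It must also be infinite, so that it can be listed by
  \<open>nat\<close> without repetition.\<close>

lemma (in Metric_space) exists_countable_splitting: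
  assumes perfect: "\<forall>x\<in>M. \<not> openin mtopology {x}"
    and V: "openin mtopology V" "V \<noteq> {}" "countable_chain_condition mtopology V"
    and "\<epsilon> > 0"
  obtains F :: "nat \<Rightarrow> 'a set" where
    "\<And>n. openin mtopology (F n)" "\<And>n. F n \<noteq> {}" "\<And>n. mtopology closure_of F n \<subseteq> V"
    "\<And>n x y. x \<in> F n \<Longrightarrow> y \<in> F n \<Longrightarrow> d x y < \<epsilon>"
    "\<And>m n. m \<noteq> n \<Longrightarrow> F m \<inter> F n = {}"
    "\<And>W. openin mtopology W \<Longrightarrow> W \<noteq> {} \<Longrightarrow> W \<subseteq> V \<Longrightarrow> \<exists>n. W \<inter> F n \<noteq> {}"
proof -
  obtain p where p: "p \<in> V"
    using V by blast
  \<comment> \<open>Keeping the closures away from \<open>p\<close> forces the maximal disjoint family to be infinite.\<close>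
  define \<C> where "\<C> = {E. openin mtopology E \<and> E \<noteq> {} \<and> mtopology closure_of E \<subseteq> V \<and>
    p \<notin> mtopology closure_of E \<and> (\<forall>x\<in>E. \<forall>y\<in>E. d x y < \<epsilon>)}"
  have small: "\<exists>E\<in>\<C>. E \<subseteq> W" if W: "openin mtopology W" "W \<noteq> {}" "W \<subseteq> V" for W
  proof -
    obtain E where E: "openin mtopology E" "E \<noteq> {}" "mtopology closure_of E \<subseteq> W"
      "p \<notin> mtopology closure_of E" "\<And>x y. x \<in> E \<Longrightarrow> y \<in> E \<Longrightarrow> d x y < \<epsilon>"
      using exists_small_open[OF perfect W(1,2) \<open>\<epsilon> > 0\<close>] by metis
    moreover have "E \<subseteq> mtopology closure_of E"
      using E(1) by (rule openin_subset_closure_of)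
    moreover have "E \<in> \<C>"
      unfolding \<C>_def using E W(3) by (auto intro: order_trans)
    ultimately show ?thesis
      by (meson order_trans)
  qed
  have "{} \<notin> \<C>"
    by (simp add: \<C>_def)
  then obtain \<D> where \<D>: "\<D> \<subseteq> \<C>" "disjoint \<D>" and max: "\<And>C. C \<in> \<C> \<Longrightarrow> \<exists>D\<in>\<D>. C \<inter> D \<noteq> {}"
    using exists_maximal_disjoint_subfamily by metis
  have dense: "\<exists>D\<in>\<D>. W \<inter> D \<noteq> {}" if "openin mtopology W" "W \<noteq> {}" "W \<subseteq> V" for W
    using small[OF that] max by blast
  have subV: "D \<subseteq> V" if "D \<in> \<D>" for D
    using that \<D>(1) openin_subset_closure_of[of mtopology D] unfolding \<C>_def by blast
  have "countable \<D>"
    using V(3) \<D> subV unfolding countable_chain_condition_def \<C>_def by blast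
  moreover have "infinite \<D>"
  proof
    assume "finite \<D>"
    \<comment> \<open>A finite union of closures is closed and misses \<open>p\<close>, so its
      complement in \<open>V\<close> would be a nonempty open set disjoint from every
      member.\<close>
    then have "closedin mtopology (\<Union>((closure_of) mtopology ` \<D>))"
      by (intro closedin_Union) auto
    then have "openin mtopology (V - \<Union>((closure_of) mtopology ` \<D>))"
      using V(1) by (simp add: openin_diff)
    moreover have "p \<in> V - \<Union>((closure_of) mtopology ` \<D>)"
      using p \<D>(1) unfolding \<C>_def by blast
    ultimately have "\<exists>D\<in>\<D>. (V - \<Union>((closure_of) mtopology ` \<D>)) \<inter> D \<noteq> {}"
      by (intro dense) auto
    then obtain D where D: "D \<in> \<D>" "(V - \<Union>((closure_of) mtopology ` \<D>)) \<inter> D \<noteq> {}"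
      by blast
    then have "D \<subseteq> mtopology closure_of D"
      using \<D>(1) by (intro openin_subset_closure_of) (auto simp: \<C>_def)
    with D show False by blast
  qed
  ultimately have bij: "bij_betw (from_nat_into \<D>) UNIV \<D>"
    by (rule bij_betw_from_nat_into)
  define F where "F = from_nat_into \<D>"
  have F: "F n \<in> \<D>" for n
    using bij bij_betwE F_def by blast
  then have FC: "F n \<in> \<C>" for n
    using \<D>(1) by blast
  show thesis
  proof (rule that)
    show "openin mtopology (F n)" "F n \<noteq> {}" "mtopology closure_of F n \<subseteq> V" for n
      using FC[of n] unfolding \<C>_def by auto
    show "d x y < \<epsilon>" if "x \<in> F n" "y \<in> F n" for n x y
      using FC[of n] that unfolding \<C>_def by auto
    show "F m \<inter> F n = {}" if "m \<noteq> n" for m n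
    proof -
      have "F m \<noteq> F n"
        using bij that unfolding F_def bij_betw_def inj_on_def by auto
      then show ?thesis
        using F \<D>(2) disjointD by blast
    qed
    show "\<exists>n. W \<inter> F n \<noteq> {}" if W: "openin mtopology W" "W \<noteq> {}" "W \<subseteq> V" for W
    proof -
      obtain D where "D \<in> \<D>" "W \<inter> D \<noteq> {}"
        using dense W by blast
      then show ?thesis
        using bij unfolding F_def bij_betw_def by (metis imageE)
    qed
  qed
qed

section \<open>Integer sequences\<close>

text \<open>Finite sequences are stored with the latest entry first, so that extending one is \<open>(#)\<close>.\<close>

definition stem :: "(nat \<Rightarrow> nat) \<Rightarrow> nat \<Rightarrow> nat list" where
  "stem f n = rev (map f [0..<n])"

lemma stem_simps [simp]: "stem f 0 = []" "stem f (Suc n) = f n # stem f n" "length (stem f n) = n"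
  by (simp_all add: stem_def)

text \<open>Nowhere density in the Baire space, written with cylinders: since the newest entry comes
  first, \<open>t @ s\<close> is an extension of \<open>s\<close>, and its cylinder has to miss
  \<open>S\<close>.\<close>

definition nowhere_dense_seqs :: "(nat \<Rightarrow> nat) set \<Rightarrow> bool" where
  "nowhere_dense_seqs S \<longleftrightarrow> (\<forall>s. \<exists>t. \<forall>f\<in>S. stem f (length (t @ s)) \<noteq> t @ s)"

definition meager_seqs :: "(nat \<Rightarrow> nat) set set" where
  "meager_seqs = countable_unions {S. nowhere_dense_seqs S}"

section \<open>Splitting trees and their branches\<close>

text \<open>Iterates \<open>exists_countable_splitting\<close> along finite sequences; the chain
  condition is inherited by every node, so the splitting never stops.\<close>

lemma (in Metric_space) exists_splitting_tree:
  assumes perfect: "\<forall>x\<in>M. \<not> openin mtopology {x}"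
    and B: "openin mtopology B" "B \<noteq> {}" "countable_chain_condition mtopology B"
  obtains U :: "nat list \<Rightarrow> 'a set" where
    "U [] = B" "\<And>s. openin mtopology (U s)" "\<And>s. U s \<noteq> {}"
    "\<And>n s. mtopology closure_of U (n # s) \<subseteq> U s"
    "\<And>n s x y. x \<in> U (n # s) \<Longrightarrow> y \<in> U (n # s) \<Longrightarrow> d x y < inverse (Suc (length s))"
    "\<And>m n s. m \<noteq> n \<Longrightarrow> U (m # s) \<inter> U (n # s) = {}"
    "\<And>s W. openin mtopology W \<Longrightarrow> W \<noteq> {} \<Longrightarrow> W \<subseteq> U s \<Longrightarrow> \<exists>n. W \<inter> U (n # s) \<noteq> {}"
proof -
  define ok where
    "ok V \<longleftrightarrow> openin mtopology V \<and> V \<noteq> {} \<and> countable_chain_condition mtopology V" for V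
  define split where "split k V F \<longleftrightarrow>
    (\<forall>n. openin mtopology (F n) \<and> F n \<noteq> {} \<and> mtopology closure_of F n \<subseteq> V \<and>
      (\<forall>x\<in>F n. \<forall>y\<in>F n. d x y < inverse (Suc k))) \<and>
    (\<forall>m n. m \<noteq> n \<longrightarrow> F m \<inter> F n = {}) \<and>
    (\<forall>W. openin mtopology W \<and> W \<noteq> {} \<and> W \<subseteq> V \<longrightarrow> (\<exists>n. W \<inter> F n \<noteq> {}))"
    for k :: nat and V and F :: "nat \<Rightarrow> 'a set"
  \<comment> \<open>Guarding by \<open>ok V\<close> makes the choice total in \<open>V\<close>, so
    \<open>U\<close> can be defined by recursion first and \<open>ok\<close> verified along it
    afterwards.\<close>
  have "\<forall>k V. \<exists>F. ok V \<longrightarrow> split k V F"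
  proof (intro allI, cases)
    fix k V assume "ok V"
    have V: "openin mtopology V" "V \<noteq> {}" "countable_chain_condition mtopology V"
      using \<open>ok V\<close> by (auto simp: ok_def)
    have "inverse (real (Suc k)) > 0" by simp
    from exists_countable_splitting[OF perfect V this]
    obtain F :: "nat \<Rightarrow> 'a set" where
      "\<And>n. openin mtopology (F n)" "\<And>n. F n \<noteq> {}" "\<And>n. mtopology closure_of F n \<subseteq> V"
      "\<And>n x y. x \<in> F n \<Longrightarrow> y \<in> F n \<Longrightarrow> d x y < inverse (real (Suc k))"
      "\<And>m n. m \<noteq> n \<Longrightarrow> F m \<inter> F n = {}"
      "\<And>W. openin mtopology W \<Longrightarrow> W \<noteq> {} \<Longrightarrow> W \<subseteq> V \<Longrightarrow> \<exists>n. W \<inter> F n \<noteq> {}"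
      by metis
    then have "split k V F"
      unfolding split_def by simp
    then show "\<exists>F. ok V \<longrightarrow> split k V F" by blast
  qed blast
  then obtain F where F: "\<And>k V. ok V \<Longrightarrow> split k V (F k V)"
    by metis
  \<comment> \<open>The node \<open>n # s\<close> is the \<open>n\<close>-th piece in the splitting
    of its parent \<open>V = U s\<close>, at the scale given by the level
    \<open>length s\<close>.\<close>
  define U where "U = rec_list B (\<lambda>n s V. F (length s) V n)"
  have U_simps: "U [] = B" "U (n # s) = F (length s) (U s) n" for n s
    by (simp_all add: U_def)
  have ok_U: "ok (U s)" for s
  proof (induction s)
    case Nil
    then show ?case using B by (simp add: U_simps ok_def)
  next
    case (Cons n s)
    have sp: "split (length s) (U s) (F (length s) (U s))"
      using F Cons by blast
    then have o: "openin mtopology (U (n # s))" "U (n # s) \<noteq> {}" "mtopology closure_of U (n # s) \<subseteq> U s"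
      unfolding split_def U_simps by auto
    then have "U (n # s) \<subseteq> U s"
      using openin_subset_closure_of[OF o(1)] by blast
    then show ?case
      using o(1,2) Cons countable_chain_condition_subset[of mtopology "U s" "U (n # s)"]
      by (simp add: ok_def)
  qed
  have sp: "split (length s) (U s) (\<lambda>n. U (n # s))" for s
    using F[OF ok_U[of s], of "length s"] by (simp add: U_simps)
  show thesis
  proof (rule that)
    show "U [] = B"
      by (simp add: U_simps)
    show "openin mtopology (U s)" "U s \<noteq> {}" for s
      using ok_U[of s] by (simp_all add: ok_def)
    show "mtopology closure_of U (n # s) \<subseteq> U s" for n s
      using sp[of s] by (simp add: split_def)
    show "d x y < inverse (Suc (length s))" if "x \<in> U (n # s)" "y \<in> U (n # s)" for n s x y
      using sp[of s] that by (simp add: split_def)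
    show "U (m # s) \<inter> U (n # s) = {}" if "m \<noteq> n" for m n s
      using sp[of s] that by (simp add: split_def)
    show "\<exists>n. W \<inter> U (n # s) \<noteq> {}" if "openin mtopology W" "W \<noteq> {}" "W \<subseteq> U s" for s W
      using sp[of s] that by (simp add: split_def)
  qed
qed

text \<open>By completeness every branch of the tree determines a point. Nodes form a \<pi>-base of
  \<open>B\<close>, so nowhere density can be moved both ways along \<open>\<phi>\<close>, and the
  points of \<open>B\<close> on no branch form a meager set.\<close>

lemma (in Metric_space) exists_meager_correspondence:
  assumes complete: "mcomplete"
    and perfect: "\<forall>x\<in>M. \<not> openin mtopology {x}"
    and B: "openin mtopology B" "B \<noteq> {}" "countable_chain_condition mtopology B"
  obtains \<phi> :: "(nat \<Rightarrow> nat) \<Rightarrow> 'a" where "inj \<phi>" "range \<phi> \<subseteq> B"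
    "\<And>A. A \<subseteq> B \<Longrightarrow> A \<in> meager_sets mtopology \<longleftrightarrow> \<phi> -` A \<in> meager_seqs"
proof -
  obtain U :: "nat list \<Rightarrow> 'a set" where
    U: "U [] = B" "\<And>s. openin mtopology (U s)" "\<And>s. U s \<noteq> {}"
    "\<And>n s. mtopology closure_of U (n # s) \<subseteq> U s"
    and diam: "\<And>n s x y. x \<in> U (n # s) \<Longrightarrow> y \<in> U (n # s) \<Longrightarrow> d x y < inverse (Suc (length s))"
    and disj: "\<And>m n s. m \<noteq> n \<Longrightarrow> U (m # s) \<inter> U (n # s) = {}"
    and dense: "\<And>s W. openin mtopology W \<Longrightarrow> W \<noteq> {} \<Longrightarrow> W \<subseteq> U s \<Longrightarrow> \<exists>n. W \<inter> U (n # s) \<noteq> {}"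
    using exists_splitting_tree[OF perfect B] by metis
  have UM: "U s \<subseteq> M" for s
    using U(2) openin_mtopology by blast
  have clU: "U s \<subseteq> mtopology closure_of U s" for s
    using UM by (simp add: closure_of_subset)
  have U_Cons: "U (n # s) \<subseteq> U s" for n s
    using U(4) clU by blast
  have U_append: "U (t @ s) \<subseteq> U s" for t s
    by (induction t) (use U_Cons in auto)
  have U_unique: "s = t" if "U s \<inter> U t \<noteq> {}" "length s = length t" for s t
    using that
  proof (induction s arbitrary: t)
    case (Cons m s)
    then obtain n t' where t: "t = n # t'" by (metis length_Suc_conv)
    have "U s \<inter> U t' \<noteq> {}"
      using Cons.prems(1) U_Cons t by blast
    then have "s = t'" using Cons.IH Cons.prems(2) t by simp
    then show ?case using Cons.prems(1) disj t by blast
  qed simp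
  \<comment> \<open>Density of one splitting step is iterated: a nonempty open trace on a node meets
    one of its children.\<close>
  have dense_level: "\<exists>t. length t = k \<and> W \<inter> U (t @ s) \<noteq> {}"
    if "openin mtopology W" "W \<noteq> {}" "W \<subseteq> U s" for W s k
  proof (induction k)
    case 0
    then show ?case using that by (auto simp: inf.absorb1)
  next
    case (Suc k)
    then obtain t where t: "length t = k" "W \<inter> U (t @ s) \<noteq> {}" by blast
    have "openin mtopology (W \<inter> U (t @ s))"
      using that(1) U(2) by (rule openin_Int)
    then obtain n where "W \<inter> U (t @ s) \<inter> U (n # t @ s) \<noteq> {}"
      using dense[OF _ t(2) Int_lower2] by blast
    then have "length (n # t) = Suc k \<and> W \<inter> U ((n # t) @ s) \<noteq> {}"
      using t by auto
    then show ?case by blast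
  qed
  have base: "\<exists>t. U (t @ s) \<subseteq> W" if W: "openin mtopology W" "W \<noteq> {}" "W \<subseteq> U s" for W s
  proof -
    obtain x where "x \<in> W" using W by blast
    obtain r where r: "r > 0" "mball x r \<subseteq> W"
      using W \<open>x \<in> W\<close> openin_mtopology by blast
    \<comment> \<open>A node \<open>Suc k\<close> levels below \<open>s\<close> has diameter below
      \<open>r/2\<close>, so if it meets the ball of radius \<open>r/2\<close> about
      \<open>x\<close>, it stays within radius \<open>r\<close>.\<close>
    then obtain k where k: "inverse (real (Suc k)) < r/2"
      using reals_Archimedean half_gt_zero by blast
    have "x \<in> M" using W UM \<open>x \<in> W\<close> by blast
    have "mball x (r/2) \<subseteq> mball x r"
      using r(1) by (simp add: mball_subset_concentric)
    then have "mball x (r/2) \<subseteq> U s"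
      using r W by blast
    moreover have "mball x (r/2) \<noteq> {}"
      using r \<open>x \<in> M\<close> by (metis centre_in_mball_iff empty_iff half_gt_zero)
    ultimately obtain t where t: "length t = Suc k" "mball x (r/2) \<inter> U (t @ s) \<noteq> {}"
      using dense_level[of "mball x (r/2)" s "Suc k"] by auto
    then obtain n t' where nt: "t = n # t'" by (metis length_Suc_conv)
    obtain y where y: "y \<in> mball x (r/2)" "y \<in> U (t @ s)"
      using t by blast
    have "U (t @ s) \<subseteq> W"
    proof
      fix z assume z: "z \<in> U (t @ s)"
      have "d y z < inverse (Suc (length (t' @ s)))"
        using diam[of y n "t' @ s" z] y z nt by auto
      also have "\<dots> \<le> inverse (Suc k)"
        using t nt by (intro le_imp_inverse_le) auto
      finally have "d y z < r/2" using k by simp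
      moreover have "d x z \<le> d x y + d y z"
        using triangle y z UM \<open>x \<in> M\<close> by blast
      ultimately have "z \<in> mball x r"
        using y z UM \<open>x \<in> M\<close> by auto
      then show "z \<in> W" using r by blast
    qed
    then show ?thesis by blast
  qed
  have "\<exists>x. \<forall>n. x \<in> U (stem f n)" for f
  proof -
    \<comment> \<open>The index is shifted because the root has no diameter bound, and because the
      closure of a node at level \<open>Suc n\<close> lies inside its parent at level
      \<open>n\<close>.\<close>
    define C where "C n = mtopology closure_of U (stem f (Suc n))" for n
    have "C n \<noteq> {}" for n
      using clU U(3) unfolding C_def by blast
    moreover have "decseq C"
      unfolding decseq_Suc_iff C_def
      using U(4) clU by (metis order_trans stem_simps(2))
    moreover have "\<exists>n a. C n \<subseteq> mcball a \<epsilon>" if \<epsilon>: "\<epsilon> > 0" for \<epsilon>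
    proof -
      obtain n where n: "inverse (real (Suc n)) < \<epsilon>"
        using reals_Archimedean[OF \<epsilon>] by blast
      obtain a where a: "a \<in> U (stem f (Suc n))"
        using U(3) by blast
      have "U (stem f (Suc n)) \<subseteq> mcball a \<epsilon>"
      proof
        fix z assume z: "z \<in> U (stem f (Suc n))"
        then have "d a z < inverse (Suc (length (stem f n)))"
          using a diam by (metis stem_simps(2))
        then have "d a z < \<epsilon>"
          using n by simp
        then show "z \<in> mcball a \<epsilon>"
          using a z UM by auto
      qed
      then have "C n \<subseteq> mcball a \<epsilon>"
        unfolding C_def by (intro closure_of_minimal) auto
      then show ?thesis by blast
    qed
    moreover have "closedin mtopology (C n)" for n
      by (simp add: C_def)
    ultimately have "\<Inter>(range C) \<noteq> {}"
      using complete mcomplete_nest by blast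
    then obtain x where x: "\<And>n. x \<in> C n" by blast
    have "x \<in> U (stem f n)" for n
      using x[of n] U(4)[of "f n" "stem f n"] unfolding C_def by auto
    then show ?thesis by blast
  qed
  then obtain \<phi> where \<phi>: "\<And>f n. \<phi> f \<in> U (stem f n)"
    by metis
  \<comment> \<open>Nodes of equal length are disjoint, so the preimage of a node is exactly the
    cylinder of its sequence. All transfers below rest on this.\<close>
  have \<phi>_iff: "\<phi> f \<in> U s \<longleftrightarrow> stem f (length s) = s" for f s
    using \<phi>[of f "length s"] U_unique[of "stem f (length s)" s] by auto
  have inj: "inj \<phi>"
  proof
    fix f g assume "\<phi> f = \<phi> g"
    then have "stem f (Suc n) = stem g (Suc n)" for n
      using \<phi>[of f "Suc n"] \<phi>_iff[of g "stem f (Suc n)"] by simp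
    then show "f = g" by auto
  qed
  have range: "range \<phi> \<subseteq> B"
    using \<phi>[of _ 0] U(1) by auto
  \<comment> \<open>An open set meeting \<open>B\<close> contains a node \<open>U s\<close>; an
    extension of \<open>s\<close> whose cylinder misses \<open>S\<close> gives a smaller node
    missing the image.\<close>
  have nd_image: "nowhere_dense_in mtopology (\<phi> ` S)" if S: "nowhere_dense_seqs S" for S
    unfolding nowhere_dense_in_iff
  proof (intro conjI allI impI)
    show "\<phi> ` S \<subseteq> topspace mtopology"
      using range UM[of "[]"] U(1) by auto
    fix W assume W: "openin mtopology W \<and> W \<noteq> {}"
    show "\<exists>V. openin mtopology V \<and> V \<noteq> {} \<and> V \<subseteq> W \<and> V \<inter> \<phi> ` S = {}"
    proof (cases "W \<inter> B = {}")
      case True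
      then show ?thesis using W range by blast
    next
      case False
      then obtain s where s: "U s \<subseteq> W"
        using base[of "W \<inter> B" "[]"] W B U(1) by auto
      obtain t where t: "\<forall>f\<in>S. stem f (length (t @ s)) \<noteq> t @ s"
        using S unfolding nowhere_dense_seqs_def by blast
      then have "U (t @ s) \<inter> \<phi> ` S = {}"
        using \<phi>_iff by blast
      then show ?thesis
        using U(2,3) U_append s by (meson order_trans)
    qed
  qed
  \<comment> \<open>Conversely, an open subset of \<open>U s\<close> missing \<open>N\<close>
    contains a node, whose cylinder misses the preimage.\<close>
  have nd_vimage: "nowhere_dense_seqs (\<phi> -` N)" if N: "nowhere_dense_in mtopology N" for N
    unfolding nowhere_dense_seqs_def
  proof
    fix s
    obtain W where W: "openin mtopology W" "W \<noteq> {}" "W \<subseteq> U s" "W \<inter> N = {}"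
      using N U(2,3) unfolding nowhere_dense_in_iff by meson
    then obtain t where "U (t @ s) \<subseteq> W"
      using base by blast
    then have "\<forall>f\<in>\<phi> -` N. stem f (length (t @ s)) \<noteq> t @ s"
      using W(4) \<phi>_iff by blast
    then show "\<exists>t. \<forall>f\<in>\<phi> -` N. stem f (length (t @ s)) \<noteq> t @ s"
      by blast
  qed
  \<comment> \<open>Every level of the tree is dense in \<open>B\<close>, so what it omits is
    nowhere dense. A point omitted by no level lies on a branch and equals the point of that
    branch.\<close>
  have off_range: "B - range \<phi> \<in> meager_sets mtopology"
  proof -
    define L where "L n = (\<Union>s\<in>{s. length s = n}. U s)" for n
    have "nowhere_dense_in mtopology (B - L n)" for n
      unfolding nowhere_dense_in_iff
    proof (intro conjI allI impI)
      show "B - L n \<subseteq> topspace mtopology"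
        using UM[of "[]"] U(1) by auto
      fix W assume W: "openin mtopology W \<and> W \<noteq> {}"
      show "\<exists>V. openin mtopology V \<and> V \<noteq> {} \<and> V \<subseteq> W \<and> V \<inter> (B - L n) = {}"
      proof (cases "W \<inter> B = {}")
        case True
        then show ?thesis using W by blast
      next
        case False
        then obtain t where t: "length t = n" "(W \<inter> B) \<inter> U t \<noteq> {}"
          using dense_level[of "W \<inter> B" "[]" n] W B(1) U(1) by auto
        have "openin mtopology (W \<inter> B \<inter> U t)"
          using W B(1) U(2) by blast
        moreover have "W \<inter> B \<inter> U t \<inter> (B - L n) = {}"
          using t by (auto simp: L_def)
        ultimately show ?thesis using t by blast
      qed
    qed
    then have "(\<Union>n. B - L n) \<in> meager_sets mtopology"
      by (intro meager_sets_UN nowhere_dense_imp_meager) auto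
    moreover have "B - range \<phi> \<subseteq> (\<Union>n. B - L n)"
    proof (rule ccontr)
      assume "\<not> B - range \<phi> \<subseteq> (\<Union>n. B - L n)"
      then obtain x where x: "x \<notin> range \<phi>" "\<And>n. x \<in> L n" by auto
      then have "\<forall>n. \<exists>s. length s = n \<and> x \<in> U s"
        by (auto simp: L_def)
      then obtain \<sigma> where \<sigma>: "\<And>n. length (\<sigma> n) = n" "\<And>n. x \<in> U (\<sigma> n)"
        by metis
      \<comment> \<open>The nodes containing \<open>x\<close> are nested, so each adds one entry at
        the head of the previous one; these entries form the branch.\<close>
      define f where "f n = hd (\<sigma> (Suc n))" for n
      have step: "\<sigma> (Suc n) = f n # \<sigma> n" for n
      proof -
        obtain m t where mt: "\<sigma> (Suc n) = m # t"
          using \<sigma>(1) by (metis length_Suc_conv)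
        then have "x \<in> U t" "length t = n"
          using \<sigma>(1)[of "Suc n"] \<sigma>(2)[of "Suc n"] U_Cons by auto
        then have "t = \<sigma> n"
          using U_unique[of t "\<sigma> n"] \<sigma> by auto
        then show ?thesis using mt by (simp add: f_def)
      qed
      have stem: "\<sigma> n = stem f n" for n
        by (induction n) (use step \<sigma>(1)[of 0] in auto)
      have "d x (\<phi> f) < \<epsilon>" if \<epsilon>: "\<epsilon> > 0" for \<epsilon>
      proof -
        obtain n where n: "inverse (real (Suc n)) < \<epsilon>"
          using reals_Archimedean[OF \<epsilon>] by blast
        have "d x (\<phi> f) < inverse (Suc (length (stem f n)))"
          using diam[of x "f n" "stem f n" "\<phi> f"] \<sigma>(2)[of "Suc n"] \<phi>[of f "Suc n"] stem by simp
        then show ?thesis using n by simp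
      qed
      then have "d x (\<phi> f) \<le> 0"
        by (meson not_le order_less_irrefl)
      moreover have "x \<in> M" "\<phi> f \<in> M"
        using \<sigma>(2) \<phi> UM by blast+
      ultimately have "x = \<phi> f"
        by (metis mdist_pos_less not_le)
      with x show False by blast
    qed
    ultimately show ?thesis by (rule meager_sets_subset)
  qed
  have "A \<in> meager_sets mtopology \<longleftrightarrow> \<phi> -` A \<in> meager_seqs" if A: "A \<subseteq> B" for A
  proof
    assume "A \<in> meager_sets mtopology"
    then obtain \<N> where \<N>: "countable \<N>" "\<forall>N\<in>\<N>. nowhere_dense_in mtopology N" "A = \<Union>\<N>"
      by (auto simp: meager_sets_def)
    then have "\<phi> -` A = (\<Union>N\<in>\<N>. \<phi> -` N)" by blast
    also have "\<dots> \<in> meager_seqs"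
      unfolding meager_seqs_def using \<N> nd_vimage
      by (intro countable_unions_UN countable_unions_base) auto
    finally show "\<phi> -` A \<in> meager_seqs" .
  next
    assume "\<phi> -` A \<in> meager_seqs"
    then obtain \<S> where \<S>: "countable \<S>" "\<S> \<subseteq> {S. nowhere_dense_seqs S}" "\<phi> -` A = \<Union>\<S>"
      unfolding meager_seqs_def in_countable_unions_iff by metis
    \<comment> \<open>Images of the pieces account only for points on branches; the remainder is
      absorbed by \<open>off_range\<close>.\<close>
    have "(\<Union>S\<in>\<S>. \<phi> ` S) \<in> meager_sets mtopology"
      using \<S> nd_image by (intro meager_sets_UN nowhere_dense_imp_meager) auto
    then have "(\<Union>S\<in>\<S>. \<phi> ` S) \<union> (B - range \<phi>) \<in> meager_sets mtopology"
      using off_range unfolding meager_sets_eq by (rule countable_unions_Un)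
    moreover have "A \<subseteq> (\<Union>S\<in>\<S>. \<phi> ` S) \<union> (B - range \<phi>)"
    proof
      fix x assume x: "x \<in> A"
      show "x \<in> (\<Union>S\<in>\<S>. \<phi> ` S) \<union> (B - range \<phi>)"
      proof (cases "x \<in> range \<phi>")
        case True
        then obtain f where f: "x = \<phi> f" by auto
        then have "f \<in> \<Union>\<S>"
          using x \<S>(3) by auto
        with f show ?thesis by auto
      qed (use x A in auto)
    qed
    ultimately show "A \<in> meager_sets mtopology" by (rule meager_sets_subset)
  qed
  with inj range show thesis by (rule that)
qed

section \<open>Spaces with a Polish \<open>\<pi>\<close>-base\<close>

text \<open>A family attaining the minimum for \<open>\<I>\<close> is converted into a competitor
  for \<open>\<J>\<close> of no larger size; \<open>\<K>\<^sub>0\<close> ensures that a minimum for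
  \<open>\<I>\<close> exists.\<close>

lemma additivity_ordLeq:
  assumes "\<K>\<^sub>0 \<subseteq> \<I>" "\<Union>\<K>\<^sub>0 \<notin> \<I>"
    and "\<And>\<K>. \<K> \<subseteq> \<I> \<Longrightarrow> \<Union>\<K> \<notin> \<I> \<Longrightarrow> \<exists>\<K>'. \<K>' \<subseteq> \<J> \<and> \<Union>\<K>' \<notin> \<J> \<and> |\<K>'| \<le>o |\<K>|"
  shows "additivity \<J> \<le>o additivity \<I>"
proof -
  obtain \<K> where \<K>: "\<K> \<subseteq> \<I>" "\<Union>\<K> \<notin> \<I>" "additivity \<I> = |\<K>|"
    using additivity_is_minimum(1)[OF assms(1,2)] by auto
  obtain \<K>' where \<K>': "\<K>' \<subseteq> \<J>" "\<Union>\<K>' \<notin> \<J>" "|\<K>'| \<le>o |\<K>|"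
    using assms(3)[OF \<K>(1,2)] by auto
  have "additivity \<J> \<le>o |\<K>'|"
    using additivity_is_minimum(2)[OF \<K>'(1,2)] \<K>'(1,2) by simp
  then show ?thesis
    using \<K>'(3) \<K>(3) ordLeq_transitive by metis
qed

text \<open>The \<open>n\<close>-th nowhere dense pieces from all members unite to one nowhere dense
  set, however many members there are: a test set can be shrunk into a single member, where just one
  piece is present. The part of \<open>A\<close> outside the members is nowhere dense by
  density.\<close>

lemma meager_sets_glue:
  assumes "disjoint \<D>" "\<And>D. D \<in> \<D> \<Longrightarrow> openin X D"
    and dense: "\<And>W. openin X W \<Longrightarrow> W \<noteq> {} \<Longrightarrow> \<exists>D\<in>\<D>. W \<inter> D \<noteq> {}"
    and "A \<subseteq> topspace X" "\<And>D. D \<in> \<D> \<Longrightarrow> A \<inter> D \<in> meager_sets X"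
  shows "A \<in> meager_sets X"
proof -
  have "\<forall>D\<in>\<D>. \<exists>N :: nat \<Rightarrow> 'a set. (\<forall>n. nowhere_dense_in X (N n)) \<and> A \<inter> D = (\<Union>n. N n)"
  proof
    fix D assume "D \<in> \<D>"
    then have "A \<inter> D \<in> countable_unions {N. nowhere_dense_in X N}"
      using assms(5) by (simp add: meager_sets_eq)
    moreover have "{} \<in> {N. nowhere_dense_in X N}"
      by (simp add: nowhere_dense_in_def)
    ultimately show "\<exists>N :: nat \<Rightarrow> 'a set. (\<forall>n. nowhere_dense_in X (N n)) \<and> A \<inter> D = (\<Union>n. N n)"
      using countable_unions_sequence[of "{N. nowhere_dense_in X N}" "A \<inter> D"] by simp
  qed
  then obtain N :: "'a set \<Rightarrow> nat \<Rightarrow> 'a set"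
    where N: "\<And>D n. D \<in> \<D> \<Longrightarrow> nowhere_dense_in X (N D n)"
      "\<And>D. D \<in> \<D> \<Longrightarrow> A \<inter> D = (\<Union>n. N D n)"
    by metis
  have ND: "N D n \<subseteq> D" if "D \<in> \<D>" for D n
    using N(2)[OF that] by auto
  have "nowhere_dense_in X (\<Union>D\<in>\<D>. N D n)" for n
    unfolding nowhere_dense_in_iff
  proof (intro conjI allI impI)
    show "(\<Union>D\<in>\<D>. N D n) \<subseteq> topspace X"
      using N(1) unfolding nowhere_dense_in_def by auto
    fix W assume W: "openin X W \<and> W \<noteq> {}"
    then obtain D where D: "D \<in> \<D>" "W \<inter> D \<noteq> {}"
      using dense by auto
    have "openin X (W \<inter> D)"
      using W assms(2)[OF D(1)] by (simp add: openin_Int)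
    then obtain V where V: "openin X V" "V \<noteq> {}" "V \<subseteq> W \<inter> D" "V \<inter> N D n = {}"
      using N(1)[OF D(1), of n] D(2) unfolding nowhere_dense_in_iff by metis
    have "V \<inter> N E n = {}" if "E \<in> \<D>" for E
      using V disjointD[OF assms(1) D(1) that] ND[OF that, of n] by (cases "E = D") auto
    then have "V \<inter> (\<Union>D\<in>\<D>. N D n) = {}"
      by auto
    with V show "\<exists>V. openin X V \<and> V \<noteq> {} \<and> V \<subseteq> W \<and> V \<inter> (\<Union>D\<in>\<D>. N D n) = {}"
      by auto
  qed
  then have "(\<Union>n. \<Union>D\<in>\<D>. N D n) \<in> meager_sets X"
    by (intro meager_sets_UN nowhere_dense_imp_meager) auto
  moreover have "A - \<Union>\<D> \<in> meager_sets X"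
  proof (rule nowhere_dense_imp_meager, unfold nowhere_dense_in_iff, intro conjI allI impI)
    show "A - \<Union>\<D> \<subseteq> topspace X"
      using assms(4) by auto
    fix W assume W: "openin X W \<and> W \<noteq> {}"
    then obtain D where D: "D \<in> \<D>" "W \<inter> D \<noteq> {}"
      using dense by auto
    have "openin X (W \<inter> D)"
      using W assms(2)[OF D(1)] by (simp add: openin_Int)
    moreover have "W \<inter> D \<inter> (A - \<Union>\<D>) = {}"
      using D by auto
    ultimately show "\<exists>V. openin X V \<and> V \<noteq> {} \<and> V \<subseteq> W \<and> V \<inter> (A - \<Union>\<D>) = {}"
      using D(2) by (meson Int_lower1)
  qed
  ultimately have "(\<Union>n. \<Union>D\<in>\<D>. N D n) \<union> (A - \<Union>\<D>) \<in> meager_sets X"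
    unfolding meager_sets_eq by (rule countable_unions_Un)
  moreover have "A \<subseteq> (\<Union>n. \<Union>D\<in>\<D>. N D n) \<union> (A - \<Union>\<D>)"
  proof
    fix x assume "x \<in> A"
    show "x \<in> (\<Union>n. \<Union>D\<in>\<D>. N D n) \<union> (A - \<Union>\<D>)"
    proof (cases "x \<in> \<Union>\<D>")
      case True
      then obtain D where "D \<in> \<D>" "x \<in> A \<inter> D"
        using \<open>x \<in> A\<close> by auto
      then show ?thesis
        using N(2)[of D] by auto
    qed (use \<open>x \<in> A\<close> in auto)
  qed
  ultimately show ?thesis
    by (rule meager_sets_subset)
qed

text \<open>Every member of \<open>\<D>\<close> is coded by sequences, so families with large union
  can be carried in both directions without increasing their size.\<close>

lemma additivity_meager_sets_eq_seqs:
  assumes X: "topspace X \<noteq> {}" "completely_metrizable_space X" "\<forall>x\<in>topspace X. \<not> openin X {x}"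
    and \<D>: "disjoint \<D>" "\<And>D. D \<in> \<D> \<Longrightarrow> openin X D" "\<And>D. D \<in> \<D> \<Longrightarrow> D \<noteq> {}"
      "\<And>D. D \<in> \<D> \<Longrightarrow> countable_chain_condition X D"
    and dense: "\<And>W. openin X W \<Longrightarrow> W \<noteq> {} \<Longrightarrow> \<exists>D\<in>\<D>. W \<inter> D \<noteq> {}"
  shows "additivity (meager_sets X) =o additivity meager_seqs"
proof -
  have corr: "\<exists>\<phi> :: (nat \<Rightarrow> nat) \<Rightarrow> 'a. inj \<phi> \<and> range \<phi> \<subseteq> D \<and>
      (\<forall>A. A \<subseteq> D \<longrightarrow> (A \<in> meager_sets X \<longleftrightarrow> \<phi> -` A \<in> meager_seqs))" if "D \<in> \<D>" for D
  proof -
    obtain M d where Md: "Metric_space M d" "Metric_space.mcomplete M d" "X = Metric_space.mtopology M d"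
      using X(2) unfolding completely_metrizable_space_def by auto
    interpret Metric_space M d by (rule Md(1))
    show ?thesis
      using exists_meager_correspondence[of D] Md(2) X(3) \<D>(2-4)[OF that] unfolding Md(3) by simp metis
  qed
  have to_seqs: "\<exists>\<K>'. \<K>' \<subseteq> meager_seqs \<and> \<Union>\<K>' \<notin> meager_seqs \<and> |\<K>'| \<le>o |\<K>|"
    if \<K>: "\<K> \<subseteq> meager_sets X" "\<Union>\<K> \<notin> meager_sets X" for \<K>
  proof -
    have "\<Union>\<K> \<subseteq> topspace X"
      using \<K>(1) meager_sets_subset_topspace[of _ X] by (intro Union_least) auto
    \<comment> \<open>If all traces of the union were meager, gluing would make the union meager;
      hence one member suffices for the pullback.\<close>
    then obtain D where D: "D \<in> \<D>" "\<Union>\<K> \<inter> D \<notin> meager_sets X"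
      using meager_sets_glue[OF \<D>(1,2) dense] \<K>(2) by metis
    obtain \<phi> :: "(nat \<Rightarrow> nat) \<Rightarrow> 'a" where
      \<phi>: "\<And>A. A \<subseteq> D \<Longrightarrow> A \<in> meager_sets X \<longleftrightarrow> \<phi> -` A \<in> meager_seqs"
      using corr[OF D(1)] by auto
    define \<K>' where "\<K>' = (\<lambda>K. \<phi> -` (K \<inter> D)) ` \<K>"
    have "K \<inter> D \<in> meager_sets X" if "K \<in> \<K>" for K
      using that \<K>(1) meager_sets_subset[of K X "K \<inter> D"] by auto
    then have "\<K>' \<subseteq> meager_seqs"
      using \<phi> by (auto simp: \<K>'_def simp del: vimage_Int)
    moreover have "\<Union>\<K>' = \<phi> -` (\<Union>\<K> \<inter> D)"
      by (auto simp: \<K>'_def)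
    then have "\<Union>\<K>' \<notin> meager_seqs"
      using \<phi>[of "\<Union>\<K> \<inter> D"] D(2) by simp
    ultimately show ?thesis
      unfolding \<K>'_def using card_of_image by metis
  qed
  have to_sets: "\<exists>\<K>'. \<K>' \<subseteq> meager_sets X \<and> \<Union>\<K>' \<notin> meager_sets X \<and> |\<K>'| \<le>o |\<K>|"
    if \<K>: "\<K> \<subseteq> meager_seqs" "\<Union>\<K> \<notin> meager_seqs" for \<K>
  proof -
    obtain D where D: "D \<in> \<D>"
      using dense[OF openin_topspace X(1)] by auto
    obtain \<phi> :: "(nat \<Rightarrow> nat) \<Rightarrow> 'a" where inj: "inj \<phi>" "range \<phi> \<subseteq> D"
      and \<phi>: "\<And>A. A \<subseteq> D \<Longrightarrow> A \<in> meager_sets X \<longleftrightarrow> \<phi> -` A \<in> meager_seqs"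
      using corr[OF D] by auto
    \<comment> \<open>Injectivity gives back \<open>S\<close> as the preimage of its image, so
      images both preserve and reflect meagerness.\<close>
    have im: "\<phi> ` S \<in> meager_sets X \<longleftrightarrow> S \<in> meager_seqs" for S
    proof -
      have "\<phi> ` S \<subseteq> D"
        using inj(2) by auto
      then show ?thesis
        using \<phi>[of "\<phi> ` S"] by (simp only: inj_vimage_image_eq[OF inj(1)])
    qed
    define \<K>' where "\<K>' = (`) \<phi> ` \<K>"
    have "\<K>' \<subseteq> meager_sets X"
      using \<K>(1) im by (auto simp: \<K>'_def)
    moreover have "\<Union>\<K>' = \<phi> ` (\<Union>\<K>)"
      by (auto simp: \<K>'_def)
    then have "\<Union>\<K>' \<notin> meager_sets X"
      using im \<K>(2) by simp
    ultimately show ?thesis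
      unfolding \<K>'_def using card_of_image by metis
  qed
  obtain \<K> where \<K>: "\<K> \<subseteq> meager_sets X" "\<Union>\<K> \<notin> meager_sets X"
    using exists_family_with_nonmeager_Union[OF X] .
  obtain \<K>' where \<K>': "\<K>' \<subseteq> meager_seqs" "\<Union>\<K>' \<notin> meager_seqs"
    using to_seqs[OF \<K>] by auto
  show ?thesis
    unfolding ordIso_iff_ordLeq
    using additivity_ordLeq[OF \<K>' to_sets] additivity_ordLeq[OF \<K> to_seqs] by simp
qed

text \<open>The real line is separable, so the whole line as the only member satisfies the
  conditions on \<open>\<D>\<close>.\<close>

lemma additivity_meager_real:
  "additivity (meager_sets euclideanreal) =o additivity meager_seqs"
proof (rule additivity_meager_sets_eq_seqs[where \<D> = "{UNIV}"])
  show "completely_metrizable_space euclideanreal"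
    by (rule completely_metrizable_space_euclidean)
  have "separable_space euclideanreal"
  proof -
    obtain C :: "real set" where "countable C" and "\<And>W. open W \<Longrightarrow> W \<noteq> {} \<Longrightarrow> \<exists>x\<in>C. x \<in> W"
      using countable_dense_exists[where 'a = real] by auto
    then have "x \<in> euclideanreal closure_of C" for x
      unfolding in_closure_of by (metis open_openin UNIV_I topspace_euclidean equals0D)
    then have "euclideanreal closure_of C = topspace euclideanreal"
      by auto
    with \<open>countable C\<close> show ?thesis
      unfolding separable_space_def by (intro exI[of _ C]) simp
  qed
  then show "countable_chain_condition euclideanreal D" if "D \<in> {UNIV}" for D
    using that by (intro separable_imp_countable_chain_condition) auto
  show "\<forall>x\<in>topspace euclideanreal. \<not> openin euclideanreal {x}"
    by (simp add: not_open_singleton)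
qed auto

text \<open>A maximal disjoint subfamily of the \<pi>-base is dense, as every nonempty open set
  contains a base member and this meets the subfamily. Separability of its members gives the chain
  condition.\<close>

lemma has_Polish_pi_base_imp_additivity:
  assumes X: "topspace X \<noteq> {}" "completely_metrizable_space X" "\<forall>x\<in>topspace X. \<not> openin X {x}"
    and "has_Polish_pi_base X"
  shows "additivity (meager_sets X) =o additivity (meager_sets euclideanreal)"
proof -
  obtain \<B> where \<B>: "pi_base X \<B>" "\<And>B. B \<in> \<B> \<Longrightarrow> Polish_topology (subtopology X B)"
    using assms(4) by (auto simp: has_Polish_pi_base_def)
  have "{} \<notin> \<B>"
    using \<B>(1) by (auto simp: pi_base_def)
  then obtain \<D> where \<D>: "\<D> \<subseteq> \<B>" "disjoint \<D>" "\<And>B. B \<in> \<B> \<Longrightarrow> \<exists>D\<in>\<D>. B \<inter> D \<noteq> {}"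
    using exists_maximal_disjoint_subfamily by metis
  have D: "openin X D" "D \<noteq> {}" "Polish_topology (subtopology X D)" if "D \<in> \<D>" for D
    using that \<D>(1) \<B> by (auto simp: pi_base_def)
  have "additivity (meager_sets X) =o additivity meager_seqs"
  proof (rule additivity_meager_sets_eq_seqs[OF X \<D>(2)])
    show "countable_chain_condition X D" if "D \<in> \<D>" for D
      using D[OF that] by (intro separable_imp_countable_chain_condition) (auto simp: Polish_topology_def)
    show "\<exists>D\<in>\<D>. W \<inter> D \<noteq> {}" if W: "openin X W" "W \<noteq> {}" for W
    proof -
      obtain B where "B \<in> \<B>" "B \<subseteq> W"
        using \<B>(1) W unfolding pi_base_def by metis
      then show ?thesis
        using \<D>(3)[of B] by auto
    qed
  qed (use D in auto)
  then show ?thesis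
    using additivity_meager_real ordIso_symmetric ordIso_transitive by metis
qed

section \<open>Spaces without a Polish \<open>\<pi>\<close>-base\<close>

text \<open>\<open>cardSuc natLeq\<close> is \<aleph>_1, the least cardinal above that of
  \<open>nat\<close>.\<close>

lemma uncountable_iff_cardSuc_natLeq: "\<not> countable A \<longleftrightarrow> cardSuc natLeq \<le>o |A|"
proof -
  have "\<not> countable A \<longleftrightarrow> natLeq <o |A|"
    using not_ordLeq_iff_ordLess[of natLeq "|A|"] natLeq_Well_order card_of_Well_order[of A]
    by (simp add: countable_card_le_natLeq)
  also have "\<dots> \<longleftrightarrow> cardSuc natLeq \<le>o |A|"
    by (rule cardSuc_ordLess_ordLeq[OF natLeq_Card_order card_of_Card_order])
  finally show ?thesis .
qed

lemma disjoint_glue: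
  assumes "disjoint \<D>"
  shows "\<exists>g. (\<forall>D\<in>\<D>. \<forall>x\<in>D. g x = f D x) \<and> (\<forall>x. x \<notin> \<Union>\<D> \<longrightarrow> g x = a)"
proof -
  define g where "g x = (if x \<in> \<Union>\<D> then f (SOME D. D \<in> \<D> \<and> x \<in> D) x else a)" for x
  have "g x = f D x" if D: "D \<in> \<D>" "x \<in> D" for D x
  proof -
    have "(SOME E. E \<in> \<D> \<and> x \<in> E) = D"
      using D disjointD[OF assms] by (intro some_equality) auto
    then show ?thesis
      using D by (auto simp: g_def)
  qed
  moreover have "g x = a" if "x \<notin> \<Union>\<D>" for x
    using that by (simp add: g_def)
  ultimately show ?thesis by blast
qed

lemma (in Metric_space) exists_small_disjoint_family:
  assumes V: "openin mtopology V" and "\<epsilon> > 0"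
  shows "\<exists>\<D>. disjoint \<D> \<and> (\<forall>D\<in>\<D>. openin mtopology D \<and> D \<noteq> {} \<and> D \<subseteq> V) \<and>
    (\<forall>D\<in>\<D>. \<forall>x\<in>D. \<forall>y\<in>D. d x y < \<epsilon>) \<and>
    (\<forall>W. openin mtopology W \<and> W \<noteq> {} \<and> W \<subseteq> V \<longrightarrow> (\<exists>D\<in>\<D>. W \<inter> D \<noteq> {}))"
proof -
  define \<C> where
    "\<C> = {E. openin mtopology E \<and> E \<noteq> {} \<and> E \<subseteq> V \<and> (\<forall>x\<in>E. \<forall>y\<in>E. d x y < \<epsilon>)}"
  have "{} \<notin> \<C>"
    by (simp add: \<C>_def)
  then obtain \<D> where \<D>: "\<D> \<subseteq> \<C>" "disjoint \<D>" "\<And>C. C \<in> \<C> \<Longrightarrow> \<exists>D\<in>\<D>. C \<inter> D \<noteq> {}"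
    using exists_maximal_disjoint_subfamily by metis
  show ?thesis
  proof (intro exI[of _ \<D>] conjI allI impI)
    show "disjoint \<D>" by (rule \<D>(2))
    show "\<forall>D\<in>\<D>. openin mtopology D \<and> D \<noteq> {} \<and> D \<subseteq> V" "\<forall>D\<in>\<D>. \<forall>x\<in>D. \<forall>y\<in>D. d x y < \<epsilon>"
      using \<D>(1) by (auto simp: \<C>_def)
    show "\<exists>D\<in>\<D>. W \<inter> D \<noteq> {}" if "openin mtopology W \<and> W \<noteq> {} \<and> W \<subseteq> V" for W
    proof -
      have W: "openin mtopology W" "W \<noteq> {}" "W \<subseteq> V"
        using that by auto
      obtain x where x: "x \<in> W" using W(2) by auto
      then obtain r where r: "r > 0" "mball x r \<subseteq> W"
        using W(1) openin_mtopology by metis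
      have xM: "x \<in> M"
        using x W(1) openin_mtopology by auto
      define s where "s = min r (\<epsilon>/2)"
      have s: "s > 0" "s \<le> r" "s \<le> \<epsilon>/2"
        using r(1) assms(2) by (auto simp: s_def)
      have "mball x s \<subseteq> W"
        using mball_subset_concentric[OF s(2)] r(2) by auto
      moreover have "d y z < \<epsilon>" if "y \<in> mball x s" "z \<in> mball x s" for y z
        using that s triangle[of y x z] commute[of y x] by auto
      moreover have "mball x s \<noteq> {}"
        using s(1) xM centre_in_mball_iff by blast
      ultimately have "mball x s \<in> \<C>"
        using W(3) by (auto simp: \<C>_def)
      then show ?thesis
        using \<D>(3)[of "mball x s"] \<open>mball x s \<subseteq> W\<close> by auto
    qed
  qed
qed

text \<open>One point is picked from each set of a maximal disjoint family at every scale. The chain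
  condition keeps these points countable, and the shrinking diameters make them dense.\<close>

lemma (in Metric_space) countable_chain_condition_imp_separable:
  assumes V: "openin mtopology V" and ccc: "countable_chain_condition mtopology V"
  shows "separable_space (subtopology mtopology V)"
proof -
  have VM: "V \<subseteq> M"
    using V openin_mtopology by auto
  have "\<exists>\<D>. disjoint \<D> \<and> (\<forall>D\<in>\<D>. openin mtopology D \<and> D \<noteq> {} \<and> D \<subseteq> V) \<and>
      (\<forall>D\<in>\<D>. \<forall>x\<in>D. \<forall>y\<in>D. d x y < inverse (real (Suc n))) \<and>
      (\<forall>W. openin mtopology W \<and> W \<noteq> {} \<and> W \<subseteq> V \<longrightarrow> (\<exists>D\<in>\<D>. W \<inter> D \<noteq> {}))" for n
    by (intro exists_small_disjoint_family V) simp
  then obtain \<D> where \<D>: "\<And>n. disjoint (\<D> n)"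
      "\<And>n D. D \<in> \<D> n \<Longrightarrow> openin mtopology D \<and> D \<noteq> {} \<and> D \<subseteq> V"
      "\<And>n D x y. D \<in> \<D> n \<Longrightarrow> x \<in> D \<Longrightarrow> y \<in> D \<Longrightarrow> d x y < inverse (real (Suc n))"
      "\<And>n W. openin mtopology W \<Longrightarrow> W \<noteq> {} \<Longrightarrow> W \<subseteq> V \<Longrightarrow> \<exists>D\<in>\<D> n. W \<inter> D \<noteq> {}"
    by metis
  define p where "p D = (SOME x. x \<in> D)" for D :: "'a set"
  have p: "p D \<in> D" if "D \<in> \<D> n" for D n
    using \<D>(2)[OF that] by (simp add: p_def some_in_eq)
  define C where "C = p ` (\<Union>n. \<D> n)"
  have "countable (\<D> n)" for n
    using ccc \<D>(1)[of n] \<D>(2)[of _ n] unfolding countable_chain_condition_def by simp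
  then have "countable C"
    by (simp add: C_def)
  have "C \<subseteq> V"
    using p \<D>(2) unfolding C_def by fastforce
  have "V \<subseteq> mtopology closure_of C"
  proof
    fix x assume x: "x \<in> V"
    have "\<exists>y\<in>C. y \<in> mball x r" if r: "r > 0" for r
    proof -
      obtain n where n: "inverse (real (Suc n)) < r/2"
        using reals_Archimedean[of "r/2"] r by auto
      have "openin mtopology (mball x (r/2) \<inter> V)"
        using V by (intro openin_Int) auto
      moreover have "x \<in> mball x (r/2) \<inter> V"
        using x VM r by auto
      then have "mball x (r/2) \<inter> V \<noteq> {}"
        by blast
      ultimately obtain D where D: "D \<in> \<D> n" "mball x (r/2) \<inter> V \<inter> D \<noteq> {}"
        using \<D>(4)[OF _ _ Int_lower2] by blast
      then obtain z where z: "z \<in> mball x (r/2)" "z \<in> D"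
        by blast
      have "d z (p D) < r/2"
        using \<D>(3)[OF D(1) z(2) p[OF D(1)]] n by simp
      moreover have "p D \<in> M"
        using p[OF D(1)] \<D>(2)[OF D(1)] VM by auto
      ultimately have "p D \<in> mball x r"
        using z(1) triangle[of x z "p D"] by auto
      then show ?thesis
        using D(1) by (auto simp: C_def)
    qed
    then show "x \<in> mtopology closure_of C"
      using x VM by (auto simp: metric_closure_of)
  qed
  then have "subtopology mtopology V closure_of C = V"
    using \<open>C \<subseteq> V\<close> VM by (auto simp: closure_of_subtopology Int_absorb1)
  then show ?thesis
    unfolding separable_space_def using \<open>countable C\<close> \<open>C \<subseteq> V\<close> VM
    by (intro exI[of _ C]) (auto simp: Int_absorb1)
qed

section \<open>Labellings by countable ordinals\<close>

text \<open>A maximal disjoint family of sets of diameter below \<open>\<epsilon>/2\<close> puts one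
  of its members inside each relevant ball, and each member has room for all \<aleph>_1 labels.
  Labels are elements of \<open>Field (cardSuc natLeq)\<close>, hence of type
  \<open>nat set\<close>.\<close>

lemma (in Metric_space) exists_omega1_labelling:
  assumes U: "openin mtopology U"
    and nsep: "\<And>V. openin mtopology V \<Longrightarrow> V \<noteq> {} \<Longrightarrow> V \<subseteq> U \<Longrightarrow> \<not> countable_chain_condition mtopology V"
    and "\<epsilon> > 0"
  shows "\<exists>c :: 'a \<Rightarrow> nat set. (\<forall>x. c x \<in> Field (cardSuc natLeq)) \<and>
    (\<forall>x a. mball x \<epsilon> \<subseteq> U \<longrightarrow> x \<in> U \<longrightarrow> a \<in> Field (cardSuc natLeq) \<longrightarrow>
      (\<exists>V. openin mtopology V \<and> V \<noteq> {} \<and> V \<subseteq> mball x \<epsilon> \<and> (\<forall>y\<in>V. c y = a)))"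
proof -
  let ?S = "Field (cardSuc natLeq)"
  have "?S \<noteq> {}"
    by (rule Field_cardSuc_not_empty[OF natLeq_Card_order])
  \<comment> \<open>Default label for the points that the disjoint families leave uncovered.\<close>
  then obtain a\<^sub>0 where a0: "a\<^sub>0 \<in> ?S"
    by auto
  have local: "\<exists>c. (\<forall>x. c x \<in> ?S) \<and>
      (\<forall>a\<in>?S. \<exists>W. openin mtopology W \<and> W \<noteq> {} \<and> W \<subseteq> V \<and> (\<forall>y\<in>W. c y = a))"
    if V: "openin mtopology V" "V \<noteq> {}" "V \<subseteq> U" for V
  proof -
    obtain \<G> where \<G>: "disjoint \<G>" "\<forall>G\<in>\<G>. openin mtopology G \<and> G \<noteq> {} \<and> G \<subseteq> V"
        "\<not> countable \<G>"
      using nsep[OF V] unfolding countable_chain_condition_def by metis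
    have "|?S| =o cardSuc natLeq"
      by (intro card_of_Field_ordIso cardSuc_Card_order natLeq_Card_order)
    then have "|?S| \<le>o |\<G>|"
      using \<G>(3) ordIso_ordLeq_trans by (auto simp: uncountable_iff_cardSuc_natLeq)
    \<comment> \<open>An uncountable family has at least as many members as there are labels, so
      labels can be distributed with none left out.\<close>
    then obtain h where h: "h ` \<G> = ?S"
      using card_of_ordLeq2[OF \<open>?S \<noteq> {}\<close>, of \<G>] by metis
    obtain c where c: "\<And>G x. G \<in> \<G> \<Longrightarrow> x \<in> G \<Longrightarrow> c x = h G" "\<And>x. x \<notin> \<Union>\<G> \<Longrightarrow> c x = a\<^sub>0"
      using disjoint_glue[OF \<G>(1), of "\<lambda>G x. h G" a\<^sub>0] by metis
    have "c x \<in> ?S" for x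
    proof (cases "x \<in> \<Union>\<G>")
      case True
      then show ?thesis using c(1) h by auto
    qed (simp add: c(2) a0)
    moreover have "\<exists>W. openin mtopology W \<and> W \<noteq> {} \<and> W \<subseteq> V \<and> (\<forall>y\<in>W. c y = a)" if a: "a \<in> ?S" for a
    proof -
      obtain G where "G \<in> \<G>" "h G = a"
        using h a by (metis imageE)
      then show ?thesis
        using \<G>(2) c(1) by metis
    qed
    ultimately show ?thesis by auto
  qed
  obtain \<D> where \<D>: "disjoint \<D>" "\<And>D. D \<in> \<D> \<Longrightarrow> openin mtopology D \<and> D \<noteq> {} \<and> D \<subseteq> U"
    "\<And>D x y. D \<in> \<D> \<Longrightarrow> x \<in> D \<Longrightarrow> y \<in> D \<Longrightarrow> d x y < \<epsilon>/2"
    "\<And>W. openin mtopology W \<Longrightarrow> W \<noteq> {} \<Longrightarrow> W \<subseteq> U \<Longrightarrow> \<exists>D\<in>\<D>. W \<inter> D \<noteq> {}"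
    using exists_small_disjoint_family[OF U half_gt_zero[OF \<open>\<epsilon> > 0\<close>]] by metis
  have "\<forall>D\<in>\<D>. \<exists>c. (\<forall>x. c x \<in> ?S) \<and>
      (\<forall>a\<in>?S. \<exists>W. openin mtopology W \<and> W \<noteq> {} \<and> W \<subseteq> D \<and> (\<forall>y\<in>W. c y = a))"
    using local \<D>(2) by simp
  then obtain c where c: "\<And>D x. D \<in> \<D> \<Longrightarrow> c D x \<in> ?S"
    "\<And>D a. D \<in> \<D> \<Longrightarrow> a \<in> ?S \<Longrightarrow>
      \<exists>W. openin mtopology W \<and> W \<noteq> {} \<and> W \<subseteq> D \<and> (\<forall>y\<in>W. c D y = a)"
    by metis
  obtain e where e: "\<And>D x. D \<in> \<D> \<Longrightarrow> x \<in> D \<Longrightarrow> e x = c D x" "\<And>x. x \<notin> \<Union>\<D> \<Longrightarrow> e x = a\<^sub>0"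
    using disjoint_glue[OF \<D>(1), of c a\<^sub>0] by metis
  show ?thesis
  proof (intro exI[of _ e] conjI allI impI)
    show "e x \<in> ?S" for x
    proof (cases "x \<in> \<Union>\<D>")
      case True
      then show ?thesis using c(1) e(1) by auto
    qed (simp add: e(2) a0)
    fix x a assume xa: "mball x \<epsilon> \<subseteq> U" "x \<in> U" "a \<in> ?S"
    have "x \<in> M"
      using xa(2) U openin_mtopology by auto
    have "mball x (\<epsilon>/2) \<subseteq> mball x \<epsilon>"
      using assms(3) by (intro mball_subset_concentric) auto
    moreover have "x \<in> mball x (\<epsilon>/2)"
      using \<open>x \<in> M\<close> assms(3) by simp
    ultimately have "mball x (\<epsilon>/2) \<noteq> {}" "mball x (\<epsilon>/2) \<subseteq> U"
      using xa(1) by blast+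
    then obtain D where D: "D \<in> \<D>" "mball x (\<epsilon>/2) \<inter> D \<noteq> {}"
      using \<D>(4)[of "mball x (\<epsilon>/2)"] by auto
    then obtain z where z: "z \<in> mball x (\<epsilon>/2)" "z \<in> D"
      by blast
    have "D \<subseteq> mball x \<epsilon>"
    proof
      fix y assume y: "y \<in> D"
      then have "y \<in> M"
        using \<D>(2)[OF D(1)] U openin_mtopology by auto
      then show "y \<in> mball x \<epsilon>"
        using \<D>(3)[OF D(1) z(2) y] z(1) triangle[of x z y] by auto
    qed
    obtain W where W: "openin mtopology W" "W \<noteq> {}" "W \<subseteq> D" "\<And>y. y \<in> W \<Longrightarrow> c D y = a"
      using c(2)[OF D(1) xa(3)] by metis
    have "\<forall>y\<in>W. e y = a"
      using W(3,4) e(1)[OF D(1)] by auto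
    then show "\<exists>V. openin mtopology V \<and> V \<noteq> {} \<and> V \<subseteq> mball x \<epsilon> \<and> (\<forall>y\<in>V. e y = a)"
      using W(1-3) \<open>D \<subseteq> mball x \<epsilon>\<close> by (meson order_trans)
  qed
qed

text \<open>With labellings \<open>c n\<close> at all scales, \<open>A a\<close> collects the points
  whose labels are all bounded by \<open>a\<close>. Every small ball in \<open>U\<close> contains an
  open set with a label beyond \<open>a\<close>, whereas the countably many labels of one point
  always have a common bound.\<close>

lemma (in Metric_space) exists_omega1_family:
  assumes U: "openin mtopology U"
    and nsep: "\<And>V. openin mtopology V \<Longrightarrow> V \<noteq> {} \<Longrightarrow> V \<subseteq> U \<Longrightarrow> \<not> countable_chain_condition mtopology V"
  obtains \<K> where "\<K> \<subseteq> meager_sets mtopology" "\<Union>\<K> = U" "|\<K>| \<le>o cardSuc natLeq"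
proof -
  let ?r = "cardSuc natLeq"
  let ?S = "Field ?r"
  have card: "Card_order ?r"
    by (rule cardSuc_Card_order[OF natLeq_Card_order])
  have inf: "infinite (Field natLeq)"
    by (simp add: Field_natLeq)
  then have inf': "infinite ?S"
    using cardSuc_finite[OF natLeq_Card_order] by simp
  have wo: "well_order_on ?S ?r"
    using card by (simp add: card_order_on_def)
  have refl: "(a, a) \<in> ?r" if "a \<in> ?S" for a
    using wo that by (auto simp: order_on_defs refl_on_def)
  have trans: "trans ?r" and antisym: "antisym ?r"
    using wo by (auto simp: order_on_defs)
  have "\<exists>c :: 'a \<Rightarrow> nat set. (\<forall>x. c x \<in> ?S) \<and>
      (\<forall>x a. mball x (inverse (Suc n)) \<subseteq> U \<longrightarrow> x \<in> U \<longrightarrow> a \<in> ?S \<longrightarrow>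
        (\<exists>V. openin mtopology V \<and> V \<noteq> {} \<and> V \<subseteq> mball x (inverse (Suc n)) \<and> (\<forall>y\<in>V. c y = a)))" for n
    by (intro exists_omega1_labelling U nsep) auto
  then obtain c :: "nat \<Rightarrow> 'a \<Rightarrow> nat set" where c: "\<And>n x. c n x \<in> ?S"
    "\<And>n x a. mball x (inverse (Suc n)) \<subseteq> U \<Longrightarrow> x \<in> U \<Longrightarrow> a \<in> ?S \<Longrightarrow>
      \<exists>V. openin mtopology V \<and> V \<noteq> {} \<and> V \<subseteq> mball x (inverse (Suc n)) \<and> (\<forall>y\<in>V. c n y = a)"
    by metis
  define A where "A a = {x \<in> U. \<forall>n. (c n x, a) \<in> ?r}" for a
  have "nowhere_dense_in mtopology (A a)" if a: "a \<in> ?S" for a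
    unfolding nowhere_dense_in_iff
  proof (intro conjI allI impI)
    show "A a \<subseteq> topspace mtopology"
      using openin_subset[OF U] by (auto simp: A_def)
    fix W assume W: "openin mtopology W \<and> W \<noteq> {}"
    show "\<exists>V. openin mtopology V \<and> V \<noteq> {} \<and> V \<subseteq> W \<and> V \<inter> A a = {}"
    proof (cases "W \<inter> U = {}")
      case True
      then have "W \<inter> A a = {}"
        by (auto simp: A_def)
      then show ?thesis using W by auto
    next
      case False
      then obtain x where x: "x \<in> W \<inter> U" by auto
      have "openin mtopology (W \<inter> U)"
        using W U by (simp add: openin_Int)
      then obtain \<rho> where \<rho>: "\<rho> > 0" "mball x \<rho> \<subseteq> W \<inter> U"
        using x openin_mtopology by metis
      obtain n where n: "inverse (real (Suc n)) < \<rho>"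
        using reals_Archimedean[OF \<rho>(1)] by auto
      then have ball: "mball x (inverse (Suc n)) \<subseteq> W \<inter> U"
        using mball_subset_concentric[of "inverse (Suc n)" \<rho> x] \<rho>(2) by auto
      \<comment> \<open>An infinite cardinal has no largest element; \<open>b\<close> is a label
        strictly above \<open>a\<close>.\<close>
      obtain b where b: "b \<in> ?S" "a \<noteq> b" "(a, b) \<in> ?r"
        using infinite_Card_order_limit[OF card inf' a] by auto
      then have "(b, a) \<notin> ?r"
        using antisym by (auto dest: antisymD)
      obtain V where V: "openin mtopology V" "V \<noteq> {}" "V \<subseteq> mball x (inverse (Suc n))"
          "\<And>y. y \<in> V \<Longrightarrow> c n y = b"
        using c(2)[of x n b] ball x b(1) by (metis Int_iff le_inf_iff)
      have "V \<inter> A a = {}"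
        using V(4) \<open>(b, a) \<notin> ?r\<close> by (force simp: A_def)
      moreover have "V \<subseteq> W"
        using V(3) ball by auto
      ultimately show ?thesis using V(1,2) by auto
    qed
  qed
  then have "A ` ?S \<subseteq> meager_sets mtopology"
    by (auto intro: nowhere_dense_imp_meager)
  moreover have "\<Union>(A ` ?S) = U"
  proof
    show "\<Union>(A ` ?S) \<subseteq> U"
      by (auto simp: A_def)
    show "U \<subseteq> \<Union>(A ` ?S)"
    proof
      fix x assume x: "x \<in> U"
      define B where "B = range (\<lambda>n. c n x)"
      \<comment> \<open>Regularity of the successor cardinal: a countable set covered by the
        increasing chain of initial segments lies in one of them.\<close>
      have "\<exists>i\<in>?S. B \<subseteq> {j. (j, i) \<in> ?r}"
      proof (rule cardSuc_UNION[OF natLeq_Card_order inf])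
        show "relChain ?r (\<lambda>i. {j. (j, i) \<in> ?r})"
          using trans by (auto simp: relChain_def dest: transD)
        show "B \<subseteq> (\<Union>i\<in>?S. {j. (j, i) \<in> ?r})"
          using refl c(1) by (auto simp: B_def)
        show "|B| \<le>o natLeq"
          unfolding countable_card_le_natLeq[symmetric] B_def by simp
      qed
      then show "x \<in> \<Union>(A ` ?S)"
        using x by (auto simp: A_def B_def)
    qed
  qed
  moreover have "|A ` ?S| \<le>o ?r"
    using card_of_image card_of_Field_ordIso[OF card] ordLeq_ordIso_trans by metis
  ultimately show thesis
    by (rule that)
qed

text \<open>The upper bound comes from covering a nonmeager open set by \<aleph>_1 meager sets, the
  lower bound from closure of the meager sets under countable unions.\<close>

lemma not_has_Polish_pi_base_imp_additivity:
  assumes X: "topspace X \<noteq> {}" "completely_metrizable_space X" "\<forall>x\<in>topspace X. \<not> openin X {x}"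
    and not: "\<not> has_Polish_pi_base X"
  shows "additivity (meager_sets X) =o cardSuc natLeq"
proof -
  \<comment> \<open>The largest candidate for a Polish \<pi>-base. Its failure yields
    \<open>U\<close> with no Polish nonempty open subset; since open subspaces stay completely
    metrizable, none of these can satisfy the chain condition.\<close>
  define \<B> where "\<B> = {B. openin X B \<and> B \<noteq> {} \<and> Polish_topology (subtopology X B)}"
  have "\<not> pi_base X \<B>"
    using not by (auto simp: has_Polish_pi_base_def \<B>_def)
  then obtain U where U: "openin X U" "U \<noteq> {}" "\<And>B. B \<in> \<B> \<Longrightarrow> \<not> B \<subseteq> U"
    by (auto simp: pi_base_def \<B>_def)
  obtain M d where Md: "Metric_space M d" "X = Metric_space.mtopology M d"
    using X(2) unfolding completely_metrizable_space_def by auto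
  interpret Metric_space M d by (rule Md(1))
  have "\<not> countable_chain_condition mtopology V"
    if V: "openin mtopology V" "V \<noteq> {}" "V \<subseteq> U" for V
  proof
    assume "countable_chain_condition mtopology V"
    then have "separable_space (subtopology X V)"
      unfolding Md(2) by (rule countable_chain_condition_imp_separable[OF V(1)])
    moreover have "completely_metrizable_space (subtopology X V)"
      using X(2) V(1) unfolding Md(2)[symmetric] by (rule completely_metrizable_space_openin)
    ultimately have "V \<in> \<B>"
      using V(1,2) by (simp add: \<B>_def Polish_topology_def Md(2))
    with U(3) V(3) show False by auto
  qed
  then obtain \<K> where \<K>: "\<K> \<subseteq> meager_sets X" "\<Union>\<K> = U" "|\<K>| \<le>o cardSuc natLeq"
    using exists_omega1_family[of U] U(1) unfolding Md(2)[symmetric] by metis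
  then have nonmeager: "\<Union>\<K> \<notin> meager_sets X"
    using open_not_meager[OF X(2) U(1,2)] by simp
  have "additivity (meager_sets X) \<le>o |\<K>|"
    using additivity_is_minimum(2)[OF \<K>(1) nonmeager] \<K>(1) nonmeager by simp
  then have "additivity (meager_sets X) \<le>o cardSuc natLeq"
    using \<K>(3) ordLeq_transitive by metis
  moreover obtain \<J> where \<J>: "\<J> \<subseteq> meager_sets X" "\<Union>\<J> \<notin> meager_sets X"
      "additivity (meager_sets X) = |\<J>|"
    using additivity_is_minimum(1)[OF \<K>(1) nonmeager] by auto
  have "\<not> countable \<J>"
  proof
    assume "countable \<J>"
    then have "(\<Union>J\<in>\<J>. J) \<in> meager_sets X"
      using \<J>(1) by (intro meager_sets_UN) auto
    with \<J>(2) show False by simp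
  qed
  then have "cardSuc natLeq \<le>o additivity (meager_sets X)"
    by (simp add: uncountable_iff_cardSuc_natLeq \<J>(3))
  ultimately show ?thesis
    by (simp add: ordIso_iff_ordLeq)
qed

theorem theorem2p5:
  fixes X :: "'a topology"
  assumes "topspace X \<noteq> {}"
    and "completely_metrizable_space X"
    and no_isolated_points: "\<forall>x\<in>topspace X. \<not> openin X {x}"
  shows "(has_Polish_pi_base X \<longrightarrow>
            additivity (meager_sets X) =o additivity (meager_sets euclideanreal)) \<and>
         (\<not> has_Polish_pi_base X \<longrightarrow>
            additivity (meager_sets X) =o cardSuc natLeq)"
  using has_Polish_pi_base_imp_additivity[OF assms] not_has_Polish_pi_base_imp_additivity[OF assms]
  by blast

end
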